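(* Let $n \ge 3$ and let $Z_n := \{r_1, \ldots, r_n\} \subset S_n$, where $r_k$ is the permutation of $\{1,\ldots,n\}$ that reverses the order of the first $k$ integers and fixes the rest, i.e. $r_k$ sends $(1,2,\ldots,n)$ to $(k, k-1, \ldots, 2, 1, k+1, \ldots, n)$. Let $X(S_n, Z_n)$ be the Cayley graph with vertex set $S_n$ and edges $\{g, zg\}$ for $g \in S_n$, $z \in Z_n$. Then the spectral gap of $X(S_n,Z_n)$ equals $1$.
   Context: Each $r_k$ is an involution, so $Z_n$ is symmetric and the Cayley graph is undirected and $n$-regular (counting loops; $r_1$ is the identity and gives a loop at each vertex). Its Laplacian is $\Delta = |Z_n|\,\mathrm{Id} - A$, where $A$ is the adjacency matrix (with $A_{g,h}$ the number of $z\in Z_n$ with $h = zg$). The Laplacian eigenvalues are ordered $0 = \lambda_1 \le \lambda_2 \le \cdots$, and the spectral gap is $\lambda_2(\Delta)$. *)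

theory Defs
  imports
    "HOL-Algebra.Sym_Groups"
    "HOL-Library.Multiset"
    "Jordan_Normal_Form.Char_Poly"
begin

definition prefix_reversal :: "nat \<Rightarrow> nat \<Rightarrow> nat" where
  "prefix_reversal k = (\<lambda>i. if i \<in> {1..k} then k + 1 - i else i)"

definition prefix_reversals :: "nat \<Rightarrow> (nat \<Rightarrow> nat) set" where
  "prefix_reversals n = prefix_reversal ` {1..n}"

text \<open>
  Matrices of Jordan_Normal_Form are indexed by natural numbers, so the vertices of the
  Cayley graph are listed by \<open>gs\<close>, which is meant to be a repetition-free enumeration of
  the carrier of \<open>G\<close>. The edges are \<open>{g, z \<otimes> g}\<close>, and loops count.
\<close>

definition cayley_adjacency ::
    "('a, 'b) monoid_scheme \<Rightarrow> 'a set \<Rightarrow> 'a list \<Rightarrow> real mat" where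
  "cayley_adjacency G Z gs =
     mat (length gs) (length gs)
       (\<lambda>(i, j). real (card {z \<in> Z. gs ! j = z \<otimes>\<^bsub>G\<^esub> gs ! i}))"

definition cayley_laplacian ::
    "('a, 'b) monoid_scheme \<Rightarrow> 'a set \<Rightarrow> 'a list \<Rightarrow> real mat" where
  "cayley_laplacian G Z gs =
     real (card Z) \<cdot>\<^sub>m 1\<^sub>m (length gs) - cayley_adjacency G Z gs"

text \<open>
  The real eigenvalues in increasing order, repeated according to their multiplicity as roots
  of the characteristic polynomial. For a symmetric real matrix, such as the Laplacian of a
  Cayley graph with symmetric generating set, these are all of the eigenvalues.
\<close>

definition ordered_eigenvalues :: "real mat \<Rightarrow> real list" where
  "ordered_eigenvalues M = sorted_list_of_multiset (proots (char_poly M))"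

text \<open>List positions start at 0, so position 1 holds the second smallest eigenvalue.\<close>

definition spectral_gap ::
    "('a, 'b) monoid_scheme \<Rightarrow> 'a set \<Rightarrow> 'a list \<Rightarrow> real" where
  "spectral_gap G Z gs = ordered_eigenvalues (cayley_laplacian G Z gs) ! 1"

end

theory Submission
  imports Defs "HOL-Analysis.Function_Topology"
begin

text \<open>
  Let \<open>A f g = (\<Sum>k\<le>n. f (r\<^sub>k \<circ> g))\<close> be the adjacency operator. By induction on \<open>n\<close>, the quadratic
  form of \<open>A\<close> is at most \<open>n - 1\<close> times the squared norm on functions of sum 0. It suffices to
  bound the eigenvalue \<open>\<mu>\<close> of an eigenfunction \<open>f\<close> of sum 0. For each point \<open>a\<close>, summing \<open>f\<close> over
  \<open>{g. g a = b}\<close> gives a function of \<open>b\<close> that is zero or an eigenfunction, again with eigenvalue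
  \<open>\<mu>\<close> and sum 0, of the action of the reversals on points. There every such eigenvalue is at most
  \<open>n - 1\<close>. So if \<open>\<mu> > n - 1\<close>, then \<open>f\<close> sums to 0 on each coset \<open>{g. g a = n}\<close> of the symmetric
  group on \<open>n - 1\<close> points. The reversals \<open>r\<^sub>k\<close> with \<open>k < n\<close> preserve these cosets, so by the
  induction hypothesis they contribute at most \<open>n - 2\<close> to the form, and \<open>r\<^sub>n\<close> contributes at most
  1, a contradiction. The eigenvalue \<open>n - 1\<close> is attained by \<open>g \<mapsto> \<phi> (g 1)\<close> with
  \<open>\<phi> = (0, 1, \<dots>, 1, 2 - n)\<close>.
\<close>

section \<open>Rayleigh quotients\<close>

text \<open>Each \<open>t i\<close> permutes \<open>S\<close> and is its own inverse, so
  substituting \<open>t i x\<close> for \<open>x\<close> moves it to the other factor.\<close>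

lemma sum_self_adjoint_involutions:
  fixes f g :: "'a \<Rightarrow> real"
  assumes "\<And>i x. i \<in> I \<Longrightarrow> x \<in> S \<Longrightarrow> t i x \<in> S \<and> t i (t i x) = x"
  shows "(\<Sum>x\<in>S. f x * (\<Sum>i\<in>I. g (t i x))) = (\<Sum>x\<in>S. g x * (\<Sum>i\<in>I. f (t i x)))"
proof -
  have "(\<Sum>x\<in>S. f x * g (t i x)) = (\<Sum>x\<in>S. g x * f (t i x))" if "i \<in> I" for i
    by (rule sum.reindex_bij_witness[of _ "t i" "t i"]) (use assms that in auto)
  then show ?thesis
    by (simp add: sum_distrib_left sum.swap[of _ I S])
qed

lemma sum_involutions:
  fixes f :: "'a \<Rightarrow> real"
  assumes "\<And>i x. i \<in> I \<Longrightarrow> x \<in> S \<Longrightarrow> t i x \<in> S \<and> t i (t i x) = x"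
  shows "(\<Sum>x\<in>S. \<Sum>i\<in>I. f (t i x)) = real (card I) * (\<Sum>x\<in>S. f x)"
  using sum_self_adjoint_involutions[where I = I and S = S and t = t and f = "\<lambda>_. 1" and g = f] assms
  by (simp add: mult.commute flip: sum_distrib_right)

text \<open>Variational principle: on the unit sphere of sum-zero functions the form attains its
  maximum, at an eigenfunction whose eigenvalue is that maximum. This turns eigenvalue bounds into
  form bounds.\<close>

lemma rayleigh_bound_involutions:
  fixes t :: "'i \<Rightarrow> 'a \<Rightarrow> 'a" and f :: "'a \<Rightarrow> real"
  assumes "finite S"
    and inv: "\<And>i x. i \<in> I \<Longrightarrow> x \<in> S \<Longrightarrow> t i x \<in> S \<and> t i (t i x) = x"
    and eig: "\<And>\<mu> h. (\<Sum>x\<in>S. h x) = 0 \<Longrightarrow> \<exists>x\<in>S. h x \<noteq> 0 \<Longrightarrow>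
      (\<And>x. x \<in> S \<Longrightarrow> (\<Sum>i\<in>I. h (t i x)) = \<mu> * h x) \<Longrightarrow> \<mu> \<le> c"
    and f0: "(\<Sum>x\<in>S. f x) = 0"
  shows "(\<Sum>x\<in>S. f x * (\<Sum>i\<in>I. f (t i x))) \<le> c * (\<Sum>x\<in>S. (f x)\<^sup>2)"
proof (cases "\<exists>x\<in>S. f x \<noteq> 0")
  case False
  then show ?thesis by simp
next
  case True
  define Q :: "('a \<Rightarrow> real) \<Rightarrow> real" where "Q h = (\<Sum>x\<in>S. h x * (\<Sum>i\<in>I. h (t i x)))" for h
  define N :: "('a \<Rightarrow> real) \<Rightarrow> real" where "N h = (\<Sum>x\<in>S. (h x)\<^sup>2)" for h
  have Npos: "N h > 0" if "\<exists>x\<in>S. h x \<noteq> 0" for h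
  proof -
    from that obtain x where "x \<in> S" "h x \<noteq> 0" by blast
    then show ?thesis
      unfolding N_def using \<open>finite S\<close> by (intro sum_pos2[of _ x]) auto
  qed
  \<comment> \<open>Forcing the value 0 off \<open>S\<close> makes the normalization unique and the
    box compact; on \<open>S\<close>, unit norm already implies the bounds -1 and 1.\<close>
  define K where "K = (PiE UNIV (\<lambda>x. if x \<in> S then {-1..1} else {0::real}))
    \<inter> {h. N h = 1} \<inter> {h. (\<Sum>x\<in>S. h x) = 0}"
  have cont: "continuous_on UNIV N" "continuous_on UNIV Q"
    "continuous_on UNIV (\<lambda>h::'a\<Rightarrow>real. \<Sum>x\<in>S. h x)"
    unfolding N_def Q_def by (intro continuous_intros continuous_on_product_coordinates)+
  have "compactin (product_topology (\<lambda>_. euclidean) UNIV)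
      (PiE UNIV (\<lambda>x. if x \<in> S then {-1..1} else {0::real}))"
    by (subst compactin_PiE) auto
  then have "compact (PiE UNIV (\<lambda>x. if x \<in> S then {-1..1} else {0::real}))"
    by (simp add: euclidean_product_topology)
  moreover have "closed {h. N h = 1}" "closed {h::'a\<Rightarrow>real. (\<Sum>x\<in>S. h x) = 0}"
    by (intro closed_Collect_eq cont continuous_on_const)+
  ultimately have "compact K"
    unfolding K_def by (intro compact_Int_closed)
  have scale: "\<exists>k\<in>K. Q h = N h * Q k" if h: "(\<Sum>x\<in>S. h x) = 0" "\<exists>x\<in>S. h x \<noteq> 0" for h
  proof -
    define k where "k x = (if x \<in> S then h x / sqrt (N h) else 0)" for x
    have N: "N h > 0" using Npos h by blast
    have N1: "N k = 1"
      unfolding N_def[of k] k_def using N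
      by (simp add: power_divide flip: sum_divide_distrib N_def)
    have "(\<Sum>x\<in>S. k x) = 0"
      using h(1) by (simp add: k_def flip: sum_divide_distrib)
    moreover have "k x \<in> {-1..1}" if "x \<in> S" for x
    proof -
      have "(k x)\<^sup>2 \<le> N k"
        unfolding N_def using that \<open>finite S\<close> by (intro member_le_sum) auto
      then show ?thesis using N1 by (simp add: abs_square_le_1 abs_le_iff)
    qed
    ultimately have "k \<in> K"
      unfolding K_def using N1 by (auto simp: k_def)
    moreover have "Q h = N h * Q k"
      unfolding Q_def using N inv
      by (simp add: k_def sum_distrib_left flip: sum_divide_distrib)
        (simp add: flip: sum_distrib_left)
    ultimately show ?thesis by blast
  qed
  have "K \<noteq> {}" using scale[OF f0 True] by blast
  then obtain h where hK: "h \<in> K" and hmax: "\<And>k. k \<in> K \<Longrightarrow> Q k \<le> Q h"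
    using continuous_attains_sup[OF \<open>compact K\<close> _ continuous_on_subset[OF cont(2) subset_UNIV]]
    by blast
  define m where "m = Q h"
  have max: "Q k \<le> m * N k" if "(\<Sum>x\<in>S. k x) = 0" for k
  proof (cases "\<exists>x\<in>S. k x \<noteq> 0")
    case True
    then show ?thesis
      using scale[OF that True] hmax Npos[OF True]
      by (metis m_def mult.commute mult_le_cancel_left_pos)
  next
    case False
    then show ?thesis by (simp add: Q_def N_def)
  qed
  have h1: "N h = 1" and h0: "(\<Sum>x\<in>S. h x) = 0"
    using hK by (auto simp: K_def)
  \<comment> \<open>The maximizer \<open>h\<close> is an eigenfunction: moving it in the direction of the residual \<open>w\<close>
    would increase the quotient to first order unless \<open>w = 0\<close>.\<close>
  define w where "w x = (\<Sum>i\<in>I. h (t i x)) - m * h x" for x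
  have w0: "(\<Sum>x\<in>S. w x) = 0"
    unfolding w_def
    by (simp add: sum_subtractf sum_involutions[of I S t, OF inv] h0 flip: sum_distrib_left)
  \<comment> \<open>This is \<open>max\<close> at \<open>h + s w\<close>, expanded in
    \<open>s\<close>: self-adjointness merges the cross terms, which leaves the first-order
    coefficient \<open>2 (X - m Y) = 2 N w\<close>.\<close>
  have quad: "2 * s * N w + s\<^sup>2 * (Q w - m * N w) \<le> 0" for s
  proof -
    define X where "X = (\<Sum>x\<in>S. w x * (\<Sum>i\<in>I. h (t i x)))"
    define Y where "Y = (\<Sum>x\<in>S. w x * h x)"
    have NX: "X = N w + m * Y"
    proof -
      have "N w = (\<Sum>x\<in>S. w x * ((\<Sum>i\<in>I. h (t i x)) - m * h x))"
        unfolding N_def by (simp add: w_def power2_eq_square)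
      then show ?thesis
        by (simp add: X_def Y_def right_diff_distrib sum_subtractf sum_distrib_left
            mult.left_commute)
    qed
    have "Q (\<lambda>x. h x + s * w x) = Q h + s * (\<Sum>x\<in>S. w x * (\<Sum>i\<in>I. h (t i x)))
      + s * (\<Sum>x\<in>S. h x * (\<Sum>i\<in>I. w (t i x))) + s\<^sup>2 * Q w"
      unfolding Q_def
      by (simp add: sum.distrib sum_distrib_left algebra_simps power2_eq_square)
    moreover have "(\<Sum>x\<in>S. h x * (\<Sum>i\<in>I. w (t i x))) = (\<Sum>x\<in>S. w x * (\<Sum>i\<in>I. h (t i x)))"
      by (rule sum_self_adjoint_involutions[of I S t, OF inv])
    moreover have "N (\<lambda>x. h x + s * w x) = N h + 2 * s * (\<Sum>x\<in>S. w x * h x) + s\<^sup>2 * N w"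
      unfolding N_def
      by (simp add: sum.distrib sum_distrib_left algebra_simps power2_eq_square)
    moreover have "Q (\<lambda>x. h x + s * w x) \<le> m * N (\<lambda>x. h x + s * w x)"
      by (rule max) (simp add: sum.distrib h0 w0 flip: sum_distrib_left)
    ultimately have "m + 2 * s * X + s\<^sup>2 * Q w \<le> m * (1 + 2 * s * Y + s\<^sup>2 * N w)"
      using h1 by (simp add: m_def X_def Y_def)
    then show ?thesis
      using NX by (simp add: algebra_simps)
  qed
  have "\<forall>x\<in>S. w x = 0"
  proof (rule ccontr)
    assume "\<not> ?thesis"
    then have pos: "N w > 0" using Npos by blast
    define C where "C = Q w - m * N w"
    \<comment> \<open>Small enough that the quadratic term is at most \<open>s N w\<close> in
      absolute value, half of the linear term \<open>2 s N w\<close>.\<close>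
    define s where "s = N w / (1 + \<bar>C\<bar>)"
    have s: "s > 0" using pos by (simp add: s_def add_pos_nonneg)
    have "s * \<bar>C\<bar> \<le> N w"
      using pos by (simp add: s_def divide_simps mult_left_mono)
    moreover have "s * (- C) \<le> s * \<bar>C\<bar>"
      using s by (intro mult_left_mono) auto
    ultimately have "2 * N w + s * C > 0"
      using pos by simp
    then have "s * (2 * N w + s * C) > 0" using s by simp
    then show False
      using quad[of s] by (simp add: C_def algebra_simps power2_eq_square)
  qed
  then have "(\<Sum>i\<in>I. h (t i x)) = m * h x" if "x \<in> S" for x
    using that by (simp add: w_def)
  moreover have "\<exists>x\<in>S. h x \<noteq> 0"
  proof (rule ccontr)
    assume "\<not> ?thesis"
    then have "N h = 0" by (simp add: N_def)
    then show False using h1 by simp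
  qed
  ultimately have "m \<le> c"
    using eig[OF h0] by blast
  then have "m * N f \<le> c * N f"
    using Npos[OF True] by simp
  then show ?thesis
    using max[OF f0] by (simp add: Q_def N_def)
qed

section \<open>Eigenvalues of the prefix reversals\<close>

lemma prefix_reversal_involution: "prefix_reversal k (prefix_reversal k i) = i"
  by (auto simp: prefix_reversal_def)

lemma prefix_reversal_permutes: "k \<le> n \<Longrightarrow> prefix_reversal k permutes {1..n}"
  by (rule bij_imp_permutes)
    (auto intro!: bij_betw_byWitness[where f' = "prefix_reversal k"]
      simp: prefix_reversal_involution, auto simp: prefix_reversal_def)

lemma prefix_reversal_comp_involution: "prefix_reversal k \<circ> (prefix_reversal k \<circ> g) = g"
  by (simp add: fun_eq_iff prefix_reversal_involution)

lemma inj_on_prefix_reversal: "inj_on prefix_reversal {1..n}"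
proof (rule inj_onI)
  fix k l assume "k \<in> {1..n}" "l \<in> {1..n}" and eq: "prefix_reversal k = prefix_reversal l"
  with fun_cong[OF eq, of 1] show "k = l"
    by (simp add: prefix_reversal_def)
qed

text \<open>Reversals with \<open>k < b\<close> fix \<open>b\<close>; for \<open>k\<close> from
  \<open>b\<close> to \<open>n\<close> the image \<open>k + 1 - b\<close> runs through the points
  from 1 to \<open>n + 1 - b\<close>.\<close>

lemma sum_prefix_reversal_point:
  fixes \<phi> :: "nat \<Rightarrow> real"
  assumes "b \<in> {1..n}"
  shows "(\<Sum>k=1..n. \<phi> (prefix_reversal k b)) = real (b - 1) * \<phi> b + (\<Sum>j=1..n+1-b. \<phi> j)"
proof -
  have split: "{1..n} = {1..<b} \<union> {b..n}" using assms by auto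
  have "(\<Sum>k=1..n. \<phi> (prefix_reversal k b)) =
      (\<Sum>k\<in>{1..<b}. \<phi> (prefix_reversal k b)) + (\<Sum>k\<in>{b..n}. \<phi> (prefix_reversal k b))"
    unfolding split by (rule sum.union_disjoint) auto
  moreover have "(\<Sum>k\<in>{1..<b}. \<phi> (prefix_reversal k b)) = real (b - 1) * \<phi> b"
    by (simp add: prefix_reversal_def)
  moreover have "(\<Sum>k\<in>{b..n}. \<phi> (prefix_reversal k b)) = (\<Sum>j=1..n+1-b. \<phi> j)"
    by (rule sum.reindex_bij_witness[of _ "\<lambda>j. j + b - 1" "\<lambda>k. k + 1 - b"])
      (use assms in \<open>auto simp: prefix_reversal_def\<close>)
  ultimately show ?thesis by simp
qed

text \<open>Since \<open>\<mu>\<close> exceeds \<open>b - 1\<close>, the equation at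
  \<open>b\<close> equates a nonzero multiple of \<open>\<phi> b\<close> with a prefix sum. Hence
  \<open>\<phi> b\<close> vanishes once the prefix sum of length \<open>n + 1 - b\<close>
  does.\<close>

lemma point_eigenfunction_eq_0:
  fixes \<phi> :: "nat \<Rightarrow> real"
  assumes eig: "\<And>b. b \<in> {1..n} \<Longrightarrow> (\<Sum>k=1..n. \<phi> (prefix_reversal k b)) = \<mu> * \<phi> b"
    and sum0: "(\<Sum>b=1..n. \<phi> b) = 0"
    and \<mu>: "\<mu> > real n - 1"
    and b: "b \<in> {1..n}"
  shows "\<phi> b = 0"
proof -
  have eq: "(\<mu> - real (b - 1)) * \<phi> b = (\<Sum>j=1..n+1-b. \<phi> j)" if "b \<in> {1..n}" for b
    using eig[OF that] sum_prefix_reversal_point[OF that, of \<phi>] by (simp add: left_diff_distrib)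
  \<comment> \<open>The zeros propagate inwards, alternating between the two ends of \<open>{1..n}\<close>.\<close>
  have "\<forall>i\<in>{1..n}. i \<le> j \<or> n + 1 \<le> i + j \<longrightarrow> \<phi> i = 0" if "j \<le> n" for j
    using that
  proof (induction j)
    case (Suc j)
    then have IH: "\<And>i. i \<in> {1..n} \<Longrightarrow> i \<le> j \<or> n + 1 \<le> i + j \<Longrightarrow> \<phi> i = 0" by auto
    \<comment> \<open>The last \<open>j\<close> values vanish by \<open>IH\<close>, so the prefix
      sum in the equation at \<open>Suc j\<close> is the total.\<close>
    have "(\<Sum>i=1..n-j. \<phi> i) = (\<Sum>i=1..n. \<phi> i)"
      by (rule sum.mono_neutral_left) (auto intro!: IH)
    then have low: "\<phi> (Suc j) = 0"
      using eq[of "Suc j"] sum0 \<mu> Suc.prems by auto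
    \<comment> \<open>The prefix sum in the equation at \<open>n - j\<close> has length
      \<open>Suc j\<close>, and all its terms now vanish.\<close>
    have "(\<Sum>i=1..Suc j. \<phi> i) = 0"
      by (rule sum.neutral) (use IH low Suc.prems in \<open>auto simp: le_Suc_eq\<close>)
    then have high: "\<phi> (n - j) = 0"
      using eq[of "n - j"] \<mu> Suc.prems by (auto simp: Suc_diff_le)
    show ?case
    proof (intro ballI impI)
      fix i assume "i \<in> {1..n}" "i \<le> Suc j \<or> n + 1 \<le> i + Suc j"
      then consider "i \<le> j \<or> n + 1 \<le> i + j" | "i = Suc j" | "i = n - j"
        by fastforce
      then show "\<phi> i = 0"
        using IH low high \<open>i \<in> {1..n}\<close> by cases auto
    qed
  qed simp
  from this[of n] show ?thesis using b by auto
qed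

section \<open>Induction over cosets of the smaller symmetric group\<close>

text \<open>Right multiplication by the transposition commutes with left multiplication by
  reversals, so the form bound for \<open>m\<close> transfers along this bijection to the
  coset.\<close>

lemma permutations_moving_to_top:
  assumes "a \<in> {1..Suc m}"
  shows "bij_betw (\<lambda>p. p \<circ> Transposition.transpose a (Suc m)) {p. p permutes {1..m}}
    {g. g permutes {1..Suc m} \<and> g a = Suc m}"
proof -
  let ?t = "Transposition.transpose a (Suc m)"
  have t: "?t permutes {1..Suc m}"
    using assms by (intro permutes_swap_id) auto
  show ?thesis
  proof (rule bij_betw_byWitness[where f' = "\<lambda>g. g \<circ> ?t"])
    show "(\<lambda>p. p \<circ> ?t) ` {p. p permutes {1..m}} \<subseteq> {g. g permutes {1..Suc m} \<and> g a = Suc m}"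
    proof safe
      fix p assume p: "p permutes {1..m}"
      then have "p permutes {1..Suc m}" by (rule permutes_subset) auto
      then show "p \<circ> ?t permutes {1..Suc m}" using t by (rule permutes_compose[rotated])
      show "(p \<circ> ?t) a = Suc m" using p by (simp add: permutes_not_in)
    qed
    show "(\<lambda>g. g \<circ> ?t) ` {g. g permutes {1..Suc m} \<and> g a = Suc m} \<subseteq> {p. p permutes {1..m}}"
    proof safe
      fix g assume "g permutes {1..Suc m}" and top: "g a = Suc m"
      then have "g \<circ> ?t permutes {1..Suc m}" using t by (intro permutes_compose)
      then show "g \<circ> ?t permutes {1..m}"
        by (rule permutes_superset) (auto simp: top le_Suc_eq)
    qed
  qed (auto simp: comp_assoc)
qed

text \<open>Phrased with the quadratic form because the induction applies it to restrictions to
  cosets, which need not be eigenfunctions.\<close>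

definition reversal_gap_bound :: "nat \<Rightarrow> bool" where
  "reversal_gap_bound n \<longleftrightarrow> (\<forall>f :: (nat \<Rightarrow> nat) \<Rightarrow> real. (\<Sum>g | g permutes {1..n}. f g) = 0 \<longrightarrow>
     (\<Sum>g | g permutes {1..n}. f g * (\<Sum>k=1..n. f (prefix_reversal k \<circ> g)))
       \<le> (real n - 1) * (\<Sum>g | g permutes {1..n}. (f g)\<^sup>2))"

lemma reversal_comp_permutes:
  assumes "k \<in> {1..n}" "g permutes {1..n}"
  shows "prefix_reversal k \<circ> g permutes {1..n}"
  using assms by (intro permutes_compose prefix_reversal_permutes) auto

lemma form_bound_of_coset_sums_0:
  fixes f :: "(nat \<Rightarrow> nat) \<Rightarrow> real"
  assumes IH: "reversal_gap_bound m"
    and coset: "\<And>a. a \<in> {1..Suc m} \<Longrightarrow> (\<Sum>g | g permutes {1..Suc m} \<and> g a = Suc m. f g) = 0"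
  shows "(\<Sum>g | g permutes {1..Suc m}. f g * (\<Sum>k=1..Suc m. f (prefix_reversal k \<circ> g)))
    \<le> real m * (\<Sum>g | g permutes {1..Suc m}. (f g)\<^sup>2)"
proof -
  let ?S = "{g. g permutes {1..Suc m}}"
  let ?C = "\<lambda>a. {g. g permutes {1..Suc m} \<and> g a = Suc m}"
  have fin: "finite ?S" by (simp add: finite_permutations)
  \<comment> \<open>Each permutation \<open>g\<close> lies in exactly one coset, indexed by the
    preimage of \<open>Suc m\<close> under \<open>g\<close>.\<close>
  have part: "(\<Sum>g\<in>?S. F g) = (\<Sum>a\<in>{1..Suc m}. \<Sum>g\<in>?C a. F g)" for F :: "(nat \<Rightarrow> nat) \<Rightarrow> real"
  proof -
    have "(\<Sum>a\<in>{1..Suc m}. sum F {g \<in> ?S. Hilbert_Choice.inv g (Suc m) = a}) = sum F ?S"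
    proof (rule sum.group[OF fin])
      show "(\<lambda>g. Hilbert_Choice.inv g (Suc m)) ` ?S \<subseteq> {1..Suc m}"
        using permutes_in_image[OF permutes_inv, of _ "{1..Suc m}" "Suc m"] by auto
    qed simp
    moreover have "{g \<in> ?S. Hilbert_Choice.inv g (Suc m) = a} = ?C a" for a
      by (auto simp: permutes_inv_eq)
    ultimately show ?thesis by simp
  qed
  have low: "(\<Sum>g\<in>?C a. f g * (\<Sum>k=1..m. f (prefix_reversal k \<circ> g)))
      \<le> (real m - 1) * (\<Sum>g\<in>?C a. (f g)\<^sup>2)" if a: "a \<in> {1..Suc m}" for a
  proof -
    let ?t = "Transposition.transpose a (Suc m)"
    note re = sum.reindex_bij_betw[OF permutations_moving_to_top[OF a]]
    have "(\<Sum>p | p permutes {1..m}. f (p \<circ> ?t)) = 0"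
      using coset[OF a] re[of f] by simp
    from IH[unfolded reversal_gap_bound_def, rule_format, OF this] show ?thesis
      unfolding re[symmetric] by (simp add: comp_assoc)
  qed
  \<comment> \<open>The last reversal permutes the group, so both squares in
    \<open>2 x y \<le> x\<^sup>2 + y\<^sup>2\<close> have the same sum.\<close>
  have "(\<Sum>g\<in>?S. f g * f (prefix_reversal (Suc m) \<circ> g)) \<le> (\<Sum>g\<in>?S. (f g)\<^sup>2)"
  proof -
    have "(\<Sum>g\<in>?S. (f (prefix_reversal (Suc m) \<circ> g))\<^sup>2) = (\<Sum>g\<in>?S. (f g)\<^sup>2)"
      by (rule sum.reindex_bij_witness[of _ "\<lambda>g. prefix_reversal (Suc m) \<circ> g"
            "\<lambda>g. prefix_reversal (Suc m) \<circ> g"])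
        (auto simp: prefix_reversal_comp_involution simp del: One_nat_def
          intro!: reversal_comp_permutes)
    moreover have "2 * (\<Sum>g\<in>?S. f g * f (prefix_reversal (Suc m) \<circ> g))
        \<le> (\<Sum>g\<in>?S. (f g)\<^sup>2 + (f (prefix_reversal (Suc m) \<circ> g))\<^sup>2)"
      unfolding sum_distrib_left
      by (intro sum_mono) (metis mult.assoc sum_squares_bound)
    ultimately show ?thesis by (simp add: sum.distrib)
  qed
  moreover have "(\<Sum>g\<in>?S. f g * (\<Sum>k=1..m. f (prefix_reversal k \<circ> g)))
      \<le> (real m - 1) * (\<Sum>g\<in>?S. (f g)\<^sup>2)"
    unfolding part sum_distrib_left[of "real m - 1"]
    by (rule sum_mono) (use low in \<open>simp add: sum_distrib_left\<close>)
  ultimately show ?thesis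
    by (simp add: distrib_left sum.distrib left_diff_distrib)
qed

lemma reversal_eigenvalue_le_of_bound:
  fixes f :: "(nat \<Rightarrow> nat) \<Rightarrow> real"
  assumes IH: "reversal_gap_bound m"
    and sum0: "(\<Sum>g | g permutes {1..Suc m}. f g) = 0"
    and nz: "\<exists>g. g permutes {1..Suc m} \<and> f g \<noteq> 0"
    and eig: "\<And>g. g permutes {1..Suc m} \<Longrightarrow> (\<Sum>k=1..Suc m. f (prefix_reversal k \<circ> g)) = \<mu> * f g"
  shows "\<mu> \<le> real m"
proof (rule ccontr)
  assume "\<not> \<mu> \<le> real m"
  then have \<mu>: "\<mu> > real m" by simp
  let ?S = "{g. g permutes {1..Suc m}}"
  have fin: "finite ?S" by (simp add: finite_permutations)
  \<comment> \<open>\<open>B a\<close> is the pushforward of \<open>f\<close> under evaluation at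
    \<open>a\<close>, which intertwines left multiplication by reversals with their action on
    points.\<close>
  define B where "B a b = (\<Sum>g | g permutes {1..Suc m} \<and> g a = b. f g)" for a b
  have "B a b = 0" if a: "a \<in> {1..Suc m}" and b: "b \<in> {1..Suc m}" for a b
  proof (rule point_eigenfunction_eq_0[where n = "Suc m" and \<mu> = \<mu> and \<phi> = "B a"])
    fix b assume "b \<in> {1..Suc m}"
    have "B a (prefix_reversal k b) =
        (\<Sum>g | g permutes {1..Suc m} \<and> g a = b. f (prefix_reversal k \<circ> g))"
      if "k \<in> {1..Suc m}" for k
      unfolding B_def
      by (rule sum.reindex_bij_witness[of _ "\<lambda>g. prefix_reversal k \<circ> g" "\<lambda>g. prefix_reversal k \<circ> g"])
        (use that in \<open>auto simp: prefix_reversal_comp_involution prefix_reversal_involution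
          simp del: One_nat_def intro!: reversal_comp_permutes\<close>)
    then have "(\<Sum>k=1..Suc m. B a (prefix_reversal k b)) =
        (\<Sum>k=1..Suc m. \<Sum>g | g permutes {1..Suc m} \<and> g a = b. f (prefix_reversal k \<circ> g))"
      by (intro sum.cong refl)
    also have "\<dots> = (\<Sum>g | g permutes {1..Suc m} \<and> g a = b. \<mu> * f g)"
      by (subst sum.swap) (intro sum.cong refl, use eig in auto)
    finally show "(\<Sum>k=1..Suc m. B a (prefix_reversal k b)) = \<mu> * B a b"
      by (simp add: B_def sum_distrib_left)
  next
    have "(\<Sum>b\<in>{1..Suc m}. sum f {g \<in> ?S. g a = b}) = sum f ?S"
    proof (rule sum.group[OF fin])
      show "(\<lambda>g. g a) ` ?S \<subseteq> {1..Suc m}"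
        using a permutes_in_image[of _ "{1..Suc m}" a] by auto
    qed simp
    then show "(\<Sum>b=1..Suc m. B a b) = 0"
      using sum0 by (simp add: B_def)
  qed (use \<mu> b in auto)
  then have "(\<Sum>g\<in>?S. f g * (\<Sum>k=1..Suc m. f (prefix_reversal k \<circ> g)))
      \<le> real m * (\<Sum>g\<in>?S. (f g)\<^sup>2)"
    by (intro form_bound_of_coset_sums_0[OF IH]) (simp add: B_def)
  also have "(\<Sum>g\<in>?S. f g * (\<Sum>k=1..Suc m. f (prefix_reversal k \<circ> g))) = (\<Sum>g\<in>?S. f g * (\<mu> * f g))"
    by (intro sum.cong refl) (use eig in auto)
  also have "\<dots> = \<mu> * (\<Sum>g\<in>?S. (f g)\<^sup>2)"
    by (simp add: sum_distrib_left power2_eq_square algebra_simps)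
  finally have "\<mu> * (\<Sum>g\<in>?S. (f g)\<^sup>2) \<le> real m * (\<Sum>g\<in>?S. (f g)\<^sup>2)" .
  moreover have "(\<Sum>g\<in>?S. (f g)\<^sup>2) > 0"
  proof -
    from nz obtain g where "g permutes {1..Suc m}" "f g \<noteq> 0" by blast
    then show ?thesis using fin by (intro sum_pos2[of _ g]) auto
  qed
  ultimately show False using \<mu> by simp
qed

text \<open>Each step alternates: the form bound gives the eigenvalue bound one size up, and
  \<open>rayleigh_bound_involutions\<close> turns that back into a form bound.\<close>

lemma reversal_gap_bound_Suc: "reversal_gap_bound (Suc m)"
proof (induction m)
  case 0
  \<comment> \<open>The group is trivial, so a function of sum 0 is zero on it.\<close>
  have "{g. g permutes {1..Suc 0}} = {id}" by (auto simp: permutes_sing)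
  then show ?case by (simp add: reversal_gap_bound_def)
next
  case (Suc m)
  let ?n = "Suc (Suc m)"
  show ?case unfolding reversal_gap_bound_def
  proof (intro allI impI)
    fix f :: "(nat \<Rightarrow> nat) \<Rightarrow> real"
    assume "(\<Sum>g | g permutes {1..?n}. f g) = 0"
    then show "(\<Sum>g | g permutes {1..?n}. f g * (\<Sum>k=1..?n. f (prefix_reversal k \<circ> g)))
       \<le> (real ?n - 1) * (\<Sum>g | g permutes {1..?n}. (f g)\<^sup>2)"
    proof (rule rayleigh_bound_involutions[rotated 3])
      show "finite {g. g permutes {1..?n}}" by (simp add: finite_permutations)
    next
      fix k and g :: "nat \<Rightarrow> nat"
      assume "k \<in> {1..?n}" "g \<in> {g. g permutes {1..?n}}"
      then show "prefix_reversal k \<circ> g \<in> {g. g permutes {1..?n}} \<and>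
          prefix_reversal k \<circ> (prefix_reversal k \<circ> g) = g"
        by (simp add: prefix_reversal_comp_involution reversal_comp_permutes del: One_nat_def)
    next
      fix \<mu> and h :: "(nat \<Rightarrow> nat) \<Rightarrow> real"
      assume "(\<Sum>g | g permutes {1..?n}. h g) = 0" "\<exists>g\<in>{g. g permutes {1..?n}}. h g \<noteq> 0"
        "\<And>g. g \<in> {g. g permutes {1..?n}} \<Longrightarrow>
          (\<Sum>k=1..?n. h (prefix_reversal k \<circ> g)) = \<mu> * h g"
      then have "\<mu> \<le> real (Suc m)"
        by (intro reversal_eigenvalue_le_of_bound[OF Suc.IH, of h]) auto
      then show "\<mu> \<le> real ?n - 1" by simp
    qed
  qed
qed

lemma reversal_eigenvalue_le:
  fixes f :: "(nat \<Rightarrow> nat) \<Rightarrow> real"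
  assumes "n \<ge> 2"
    and "(\<Sum>g | g permutes {1..n}. f g) = 0"
    and "\<exists>g. g permutes {1..n} \<and> f g \<noteq> 0"
    and "\<And>g. g permutes {1..n} \<Longrightarrow> (\<Sum>k=1..n. f (prefix_reversal k \<circ> g)) = \<mu> * f g"
  shows "\<mu> \<le> real n - 1"
proof -
  obtain m where "n = Suc (Suc m)"
    using \<open>n \<ge> 2\<close> by (metis Suc_le_D numeral_2_eq_2 Suc_le_mono)
  then show ?thesis
    using reversal_eigenvalue_le_of_bound[OF reversal_gap_bound_Suc, of f m \<mu>] assms by simp
qed

section \<open>A point eigenfunction attaining the bound\<close>

definition gap_point_function :: "nat \<Rightarrow> nat \<Rightarrow> real" where
  "gap_point_function n b = (if b \<le> 1 then 0 else if b < n then 1 else 2 - real n)"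

lemma sum_gap_point_function:
  assumes "n \<ge> 3" "m \<in> {1..n}"
  shows "(\<Sum>j=1..m. gap_point_function n j) = (if m < n then real m - 1 else 0)"
  using assms(2)
proof (induction m)
  case (Suc m)
  then show ?case using assms(1)
    by (cases "m = 0") (auto simp: gap_point_function_def of_nat_diff)
qed simp

text \<open>For \<open>b = 1\<close> the prefix sum is the total, 0. For \<open>1 < b < n\<close> it
  is \<open>n - b\<close>, which joins \<open>b - 1\<close> to give \<open>n - 1\<close>. For
  \<open>b = n\<close> it is the single value 0 at the point 1.\<close>

lemma gap_point_function_eigen:
  assumes "n \<ge> 3" "b \<in> {1..n}"
  shows "(\<Sum>k=1..n. gap_point_function n (prefix_reversal k b)) =
    (real n - 1) * gap_point_function n b"
proof -
  have "(\<Sum>j=1..n+1-b. gap_point_function n j) = (if n+1-b < n then real (n+1-b) - 1 else 0)"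
    by (rule sum_gap_point_function) (use assms in auto)
  then show ?thesis
    unfolding sum_prefix_reversal_point[OF assms(2)] using assms
    by (auto simp: gap_point_function_def of_nat_diff)
qed

section \<open>The second eigenvalue of a matrix with zero row and column sums\<close>

text \<open>The all-ones vector spans a line in the kernel; the smaller matrix is the action induced
  on the quotient by it, in the classes of the remaining unit vectors. Characteristic polynomials
  keep track of multiplicities.\<close>

lemma char_poly_row_sums_0:
  fixes M :: "'a :: field mat"
  assumes M: "M \<in> carrier_mat (Suc N) (Suc N)"
    and rows: "\<And>i. i < Suc N \<Longrightarrow> (\<Sum>j<Suc N. M $$ (i, j)) = 0"
  shows "char_poly M =
    [:0, 1:] * char_poly (mat N N (\<lambda>(i, j). M $$ (Suc i, Suc j) - M $$ (0, Suc j)))"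
proof -
  let ?M' = "mat N N (\<lambda>(i, j). M $$ (Suc i, Suc j) - M $$ (0, Suc j))"
  \<comment> \<open>Change of basis: the all-ones vector, which lies in the kernel, replaces the first unit vector.\<close>
  define P :: "'a mat" where
    "P = mat (Suc N) (Suc N) (\<lambda>(i, j). if j = 0 \<or> i = j then 1 else 0)"
  define Q :: "'a mat" where
    "Q = mat (Suc N) (Suc N) (\<lambda>(i, j). if i = j then 1 else if j = 0 then - 1 else 0)"
  \<comment> \<open>This is \<open>M\<close> in the new basis: block triangular, with zero first
    column.\<close>
  define B where
    "B = four_block_mat (0\<^sub>m 1 1) (mat 1 N (\<lambda>(i, j). M $$ (0, Suc j))) (0\<^sub>m N 1) ?M'"
  have carr: "P \<in> carrier_mat (Suc N) (Suc N)" "Q \<in> carrier_mat (Suc N) (Suc N)"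
    "B \<in> carrier_mat (Suc N) (Suc N)"
    unfolding P_def Q_def B_def by auto
  note sum_shift = scalar_prod_def sum.atLeast0_lessThan_Suc_shift
  have PQ: "P * Q = 1\<^sub>m (Suc N)"
  proof (rule eq_matI)
    fix i j assume "i < dim_row (1\<^sub>m (Suc N) :: 'a mat)" "j < dim_col (1\<^sub>m (Suc N) :: 'a mat)"
    then show "(P * Q) $$ (i, j) = 1\<^sub>m (Suc N) $$ (i, j)"
      by (cases i; cases j)
        (auto simp: P_def Q_def sum_shift if_distrib[of "\<lambda>x. x * _"] if_distrib[of "\<lambda>x. _ * x"]
          sum.delta sum.delta' sum_negf simp del: sum.op_ivl_Suc cong: if_cong)
  qed (use carr in auto)
  have QP: "Q * P = 1\<^sub>m (Suc N)"
    by (rule mat_mult_left_right_inverse[OF carr(1,2) PQ])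
  have MP: "M * P = P * B"
  proof (rule eq_matI)
    fix i j assume "i < dim_row (P * B)" "j < dim_col (P * B)"
    then have ij: "i < Suc N" "j < Suc N" using carr by auto
    have row0: "M $$ (i, 0) + (\<Sum>k = 0..<N. M $$ (i, Suc k)) = 0"
      using rows[OF ij(1)] unfolding lessThan_atLeast0 sum.atLeast0_lessThan_Suc_shift by simp
    show "(M * P) $$ (i, j) = (P * B) $$ (i, j)"
      using ij M row0
      by (cases i; cases j)
        (auto simp: P_def B_def sum_shift if_distrib[of "\<lambda>x. x * _"] if_distrib[of "\<lambda>x. _ * x"]
          sum.delta sum.delta' simp del: sum.op_ivl_Suc cong: if_cong)
  qed (use carr M in auto)
  have "M = M * (P * Q)" using M PQ by simp
  also have "\<dots> = P * B * Q"
    using M carr MP by (metis assoc_mult_mat)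
  finally have "similar_mat M B"
    using M carr PQ QP by (intro similar_matI[of _ _ P Q "Suc N"]) auto
  then have "char_poly M = char_poly B" by (rule char_poly_similar)
  also have "\<dots> = char_poly (0\<^sub>m 1 1) * char_poly ?M'"
    unfolding B_def by (rule char_poly_four_block_zeros_col) auto
  also have "char_poly (0\<^sub>m 1 1 :: 'a mat) = [:0, 1:]"
    by (simp add: char_poly_defs det_def sign_def)
  finally show ?thesis .
qed

lemma eigen_function_iff_root_char_poly:
  fixes M :: "'a :: field mat"
  assumes M: "M \<in> carrier_mat N N"
  shows "poly (char_poly M) x = 0 \<longleftrightarrow>
    (\<exists>f. (\<exists>i<N. f i \<noteq> 0) \<and> (\<forall>i<N. (\<Sum>j<N. M $$ (i, j) * f j) = x * f i))"
proof
  assume "poly (char_poly M) x = 0"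
  then obtain v where v: "v \<in> carrier_vec N" "v \<noteq> 0\<^sub>v N" "M *\<^sub>v v = x \<cdot>\<^sub>v v"
    using M unfolding eigenvalue_root_char_poly[OF M, symmetric] eigenvalue_def eigenvector_def
    by auto
  have "\<exists>i<N. v $ i \<noteq> 0"
    using v(1,2) by (metis carrier_vecD eq_vecI index_zero_vec)
  moreover have "(\<Sum>j<N. M $$ (i, j) * v $ j) = x * v $ i" if "i < N" for i
    using arg_cong[OF v(3), of "\<lambda>w. w $ i"] that M v(1)
    by (simp add: scalar_prod_def lessThan_atLeast0)
  ultimately show "\<exists>f. (\<exists>i<N. f i \<noteq> 0) \<and> (\<forall>i<N. (\<Sum>j<N. M $$ (i, j) * f j) = x * f i)"
    by (intro exI[of _ "\<lambda>i. v $ i"]) auto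
next
  assume "\<exists>f. (\<exists>i<N. f i \<noteq> 0) \<and> (\<forall>i<N. (\<Sum>j<N. M $$ (i, j) * f j) = x * f i)"
  then obtain f i where f: "i < N" "f i \<noteq> 0" "\<And>i. i < N \<Longrightarrow> (\<Sum>j<N. M $$ (i, j) * f j) = x * f i"
    by blast
  have "vec N f \<noteq> 0\<^sub>v N"
    using f(1,2) by (metis index_vec index_zero_vec(1))
  moreover have "M *\<^sub>v vec N f = x \<cdot>\<^sub>v vec N f"
    by (rule eq_vecI) (use M f(3) in \<open>auto simp: scalar_prod_def lessThan_atLeast0\<close>)
  ultimately show "poly (char_poly M) x = 0"
    using M unfolding eigenvalue_root_char_poly[OF M, symmetric] eigenvalue_def eigenvector_def
    by (intro exI[of _ "vec N f"]) auto
qed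

text \<open>The linear factor in \<open>char_poly_row_sums_0\<close> accounts for one eigenvalue 0.
  Every root of the other factor lifts to a sum-zero eigenfunction of \<open>M\<close>, so it is at
  least \<open>c\<close>, and \<open>c\<close> itself is a root there.\<close>

lemma second_ordered_eigenvalue:
  fixes M :: "real mat"
  assumes M: "M \<in> carrier_mat N N"
    and rows: "\<And>i. i < N \<Longrightarrow> (\<Sum>j<N. M $$ (i, j)) = 0"
    and cols: "\<And>j. j < N \<Longrightarrow> (\<Sum>i<N. M $$ (i, j)) = 0"
    and lower: "\<And>x f. (\<Sum>i<N. f i) = 0 \<Longrightarrow> \<exists>i<N. f i \<noteq> 0 \<Longrightarrow>
      (\<And>i. i < N \<Longrightarrow> (\<Sum>j<N. M $$ (i, j) * f j) = x * f i) \<Longrightarrow> c \<le> x"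
    and "c > 0"
    and attained: "\<exists>i<N. w i \<noteq> 0" "\<And>i. i < N \<Longrightarrow> (\<Sum>j<N. M $$ (i, j) * w j) = c * w i"
  shows "ordered_eigenvalues M ! 1 = c"
proof -
  obtain m where N: "N = Suc m" using attained(1) by (cases N) auto
  define M' where "M' = mat m m (\<lambda>(i, j). M $$ (Suc i, Suc j) - M $$ (0, Suc j))"
  have M': "M' \<in> carrier_mat m m" by (simp add: M'_def)
  define q where "q = char_poly M'"
  have q0: "q \<noteq> 0" using degree_monic_char_poly[OF M'] unfolding q_def by auto
  have char: "char_poly M = [:0, 1:] * q"
    unfolding q_def M'_def using char_poly_row_sums_0[of M m] M rows by (simp add: N)
  have "poly (char_poly M) c = 0"
    unfolding eigen_function_iff_root_char_poly[OF M] using attained by blast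
  then have root: "poly q c = 0" using \<open>c > 0\<close> by (simp add: char)
  have roots_ge: "c \<le> x" if x: "poly q x = 0" for x
  proof -
    obtain v i0 where v: "i0 < m" "v i0 \<noteq> 0"
      "\<And>i. i < m \<Longrightarrow> (\<Sum>j<m. M' $$ (i, j) * v j) = x * v i"
      using x unfolding q_def eigen_function_iff_root_char_poly[OF M'] by blast
    \<comment> \<open>\<open>u\<close> lifts \<open>v\<close> from the quotient: it is an
      eigenfunction up to the additive constant \<open>d\<close>. Subtracting its mean
      \<open>e\<close> gives sum 0 and still only a constant error.\<close>
    define u where "u i = (case i of 0 \<Rightarrow> 0 | Suc i \<Rightarrow> v i)" for i
    define d where "d = (\<Sum>j<N. M $$ (0, j) * u j)"
    define e where "e = (\<Sum>i<N. u i) / real N"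
    define f where "f i = u i - e" for i
    have u: "(\<Sum>j<N. M $$ (i, j) * u j) = x * u i + d" if "i < N" for i
    proof (cases i)
      case 0
      then show ?thesis by (simp add: u_def d_def)
    next
      case (Suc k)
      then have "k < m" using that N by simp
      then have "x * v k = (\<Sum>j<m. (M $$ (Suc k, Suc j) - M $$ (0, Suc j)) * v j)"
        using v(3)[of k] by (simp add: M'_def)
      then show ?thesis
        unfolding N d_def sum.lessThan_Suc_shift Suc
        by (simp add: u_def left_diff_distrib sum_subtractf)
    qed
    have f: "(\<Sum>j<N. M $$ (i, j) * f j) = x * f i + (x * e + d)" if "i < N" for i
      using u[OF that] rows[OF that]
      by (simp add: f_def right_diff_distrib sum_subtractf flip: sum_distrib_right)
    have f0: "(\<Sum>i<N. f i) = 0"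
      by (simp add: f_def e_def sum_subtractf N)
    \<comment> \<open>Zero column sums make the total of \<open>M f\<close> vanish, and hence the
      constant error.\<close>
    have "(\<Sum>i<N. \<Sum>j<N. M $$ (i, j) * f j) = 0"
      by (subst sum.swap) (simp add: cols flip: sum_distrib_right)
    then have "real N * (x * e + d) = 0"
      using f f0 by (simp add: sum.distrib flip: sum_distrib_left)
    then have "x * e + d = 0" by (simp add: N)
    moreover have "\<exists>i<N. f i \<noteq> 0"
    proof (rule ccontr)
      assume "\<not> ?thesis"
      then have "f 0 = 0" "f (Suc i0) = 0" using v(1) N by auto
      then show False using v(2) by (simp add: f_def u_def)
    qed
    ultimately show ?thesis
      using lower[OF f0] f by simp
  qed
  define xs where "xs = sorted_list_of_multiset (proots q)"
  have set_xs: "set xs = {x. poly q x = 0}" using q0 by (simp add: xs_def)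
  have "proots (char_poly M) = add_mset 0 (proots q)"
    unfolding char using q0 by (subst proots_mult) auto
  then have "ordered_eigenvalues M = insort 0 xs"
    unfolding ordered_eigenvalues_def xs_def by simp
  also have "\<dots> = 0 # xs"
    using set_xs roots_ge \<open>c > 0\<close> by (intro insort_is_Cons) force
  finally have "ordered_eigenvalues M ! 1 = xs ! 0" by simp
  moreover obtain y ys where xs: "xs = y # ys"
    using root set_xs by (cases xs) auto
  have "sorted xs" unfolding xs_def by (rule sorted_sorted_list_of_multiset)
  moreover have "c \<in> set xs" "c \<le> y"
    using root roots_ge set_xs by (blast, auto simp: xs set_eq_iff)
  ultimately show ?thesis unfolding xs by auto
qed

section \<open>Cayley graphs\<close>

text \<open>Turns the matrix into an operator on functions on the group: the entry at
  \<open>(i, j)\<close> counts the generators that carry vertex \<open>i\<close> to vertex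
  \<open>j\<close>, so grouping \<open>Z\<close> by image gives the right side.\<close>

lemma cayley_adjacency_apply:
  assumes "group G" "Z \<subseteq> carrier G" "finite Z" "distinct gs" "set gs = carrier G"
    and i: "i < length gs"
  shows "(\<Sum>j<length gs. cayley_adjacency G Z gs $$ (i, j) * F (gs ! j)) =
    (\<Sum>z\<in>Z. F (z \<otimes>\<^bsub>G\<^esub> gs ! i))"
proof -
  interpret group G by fact
  have gi: "gs ! i \<in> carrier G" using assms nth_mem by blast
  have fin: "finite (carrier G)" using assms(5) by (metis List.finite_set)
  have "(\<Sum>j<length gs. cayley_adjacency G Z gs $$ (i, j) * F (gs ! j)) =
      (\<Sum>j<length gs. real (card {z \<in> Z. gs ! j = z \<otimes>\<^bsub>G\<^esub> gs ! i}) * F (gs ! j))"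
    using i by (intro sum.cong) (auto simp: cayley_adjacency_def)
  also have "\<dots> = (\<Sum>g\<in>carrier G. real (card {z \<in> Z. g = z \<otimes>\<^bsub>G\<^esub> gs ! i}) * F g)"
    using assms by (intro sum.reindex_bij_betw bij_betw_nth) auto
  also have "\<dots> = (\<Sum>g\<in>carrier G. \<Sum>z | z \<in> Z \<and> z \<otimes>\<^bsub>G\<^esub> gs ! i = g. F (z \<otimes>\<^bsub>G\<^esub> gs ! i))"
  proof (rule sum.cong[OF refl])
    fix g
    have "{z \<in> Z. g = z \<otimes>\<^bsub>G\<^esub> gs ! i} = {z. z \<in> Z \<and> z \<otimes>\<^bsub>G\<^esub> gs ! i = g}" by auto
    then show "real (card {z \<in> Z. g = z \<otimes>\<^bsub>G\<^esub> gs ! i}) * F g =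
        (\<Sum>z | z \<in> Z \<and> z \<otimes>\<^bsub>G\<^esub> gs ! i = g. F (z \<otimes>\<^bsub>G\<^esub> gs ! i))" by simp
  qed
  also have "\<dots> = (\<Sum>z\<in>Z. F (z \<otimes>\<^bsub>G\<^esub> gs ! i))"
    using assms(2,3) gi fin by (intro sum.group) auto
  finally show ?thesis .
qed

lemma cayley_laplacian_apply:
  assumes "group G" "Z \<subseteq> carrier G" "finite Z" "distinct gs" "set gs = carrier G"
    and i: "i < length gs"
  shows "(\<Sum>j<length gs. cayley_laplacian G Z gs $$ (i, j) * F (gs ! j)) =
    real (card Z) * F (gs ! i) - (\<Sum>z\<in>Z. F (z \<otimes>\<^bsub>G\<^esub> gs ! i))"
proof -
  have "(\<Sum>j<length gs. cayley_laplacian G Z gs $$ (i, j) * F (gs ! j)) =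
      (\<Sum>j<length gs. (if i = j then real (card Z) * F (gs ! j) else 0)
        - cayley_adjacency G Z gs $$ (i, j) * F (gs ! j))"
    using i by (intro sum.cong)
      (auto simp: cayley_laplacian_def cayley_adjacency_def left_diff_distrib)
  then show ?thesis
    using i by (simp add: sum_subtractf cayley_adjacency_apply[OF assms])
qed

section \<open>The spectral gap of the prefix reversal graph\<close>

theorem theorem1:
  fixes n :: nat and gs :: "(nat \<Rightarrow> nat) list"
  assumes "n \<ge> 3"
    and "distinct gs" and "set gs = carrier (sym_group n)"
  shows "spectral_gap (sym_group n) (prefix_reversals n) gs = 1"
proof -
  let ?G = "sym_group n" and ?Z = "prefix_reversals n"
  let ?N = "length gs" and ?S = "{g. g permutes {1..n}}"
  define L where "L = cayley_laplacian ?G ?Z gs"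
  have S: "set gs = ?S" using assms(3) by (simp add: sym_group_def)
  have bij: "bij_betw ((!) gs) {..<?N} ?S"
    using assms(2) S by (intro bij_betw_nth) auto
  have nth: "gs ! i permutes {1..n}" if "i < ?N" for i
    using that S nth_mem by blast
  have Z: "?Z \<subseteq> carrier ?G" "finite ?Z" "card ?Z = n"
    using prefix_reversal_permutes[of _ n] card_image[OF inj_on_prefix_reversal[of n]]
    by (auto simp: prefix_reversals_def sym_group_carrier)
  have apply_L: "(\<Sum>j<?N. L $$ (i, j) * F (gs ! j)) =
      real n * F (gs ! i) - (\<Sum>k=1..n. F (prefix_reversal k \<circ> gs ! i))" if "i < ?N" for i F
    unfolding L_def
      cayley_laplacian_apply[OF sym_group_is_group Z(1,2) assms(2,3) that] Z(3)
    by (simp add: prefix_reversals_def sum.reindex[OF inj_on_prefix_reversal] sym_group_mult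
        del: One_nat_def)
  have total: "(\<Sum>i<?N. \<Sum>j<?N. L $$ (i, j) * F (gs ! j)) = 0" for F
  proof -
    have "(\<Sum>i<?N. \<Sum>j<?N. L $$ (i, j) * F (gs ! j)) =
        (\<Sum>g\<in>?S. real n * F g - (\<Sum>k=1..n. F (prefix_reversal k \<circ> g)))"
      by (subst sum.reindex_bij_betw[OF bij, symmetric]) (simp add: apply_L)
    moreover have "(\<Sum>g\<in>?S. \<Sum>k=1..n. F (prefix_reversal k \<circ> g)) = real n * (\<Sum>g\<in>?S. F g)"
      using sum_involutions[of "{1..n}" ?S "\<lambda>k g. prefix_reversal k \<circ> g" F]
      by (simp add: prefix_reversal_comp_involution reversal_comp_permutes del: One_nat_def)
    ultimately show ?thesis by (simp add: sum_subtractf sum_distrib_left)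
  qed
  have "ordered_eigenvalues L ! 1 = 1"
  proof (rule second_ordered_eigenvalue)
    show "L \<in> carrier_mat ?N ?N"
      unfolding L_def cayley_laplacian_def cayley_adjacency_def
      by (intro minus_carrier_mat mat_carrier)
  next
    fix i assume "i < ?N"
    then show "(\<Sum>j<?N. L $$ (i, j)) = 0"
      using apply_L[of i "\<lambda>_. 1"] by simp
  next
    fix j assume j: "j < ?N"
    \<comment> \<open>Column \<open>j\<close> is read off from the indicator function of
      \<open>gs ! j\<close>, so \<open>total\<close> gives its sum.\<close>
    have "(\<Sum>k<?N. L $$ (i, k) * (if gs ! k = gs ! j then 1 else 0)) = L $$ (i, j)" for i
    proof -
      have "(\<Sum>k<?N. L $$ (i, k) * (if gs ! k = gs ! j then 1 else 0)) =
          (\<Sum>k<?N. if k = j then L $$ (i, k) else 0)"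
        using j assms(2) by (intro sum.cong) (auto simp: nth_eq_iff_index_eq)
      then show ?thesis using j by simp
    qed
    then show "(\<Sum>i<?N. L $$ (i, j)) = 0"
      using total[of "\<lambda>g. if g = gs ! j then 1 else 0"] by simp
  next
    fix x f
    assume f0: "(\<Sum>i<?N. f i) = 0" and nz: "\<exists>i<?N. f i \<noteq> 0"
      and eig: "\<And>i. i < ?N \<Longrightarrow> (\<Sum>j<?N. L $$ (i, j) * f j) = x * f i"
    define F where "F g = f (inv_into {..<?N} ((!) gs) g)" for g
    have F: "F (gs ! i) = f i" if "i < ?N" for i
      using that bij by (simp add: F_def bij_betw_inv_into_left)
    \<comment> \<open>\<open>L\<close> is \<open>n\<close> minus the adjacency operator, so an
      eigenvalue \<open>x\<close> becomes \<open>n - x\<close>, to which the bound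
      \<open>n - 1\<close> applies.\<close>
    have "real n - x \<le> real n - 1"
    proof (rule reversal_eigenvalue_le[of n F])
      show "(\<Sum>g\<in>?S. F g) = 0"
        using f0 F by (subst sum.reindex_bij_betw[OF bij, symmetric]) simp
      show "\<exists>g. g permutes {1..n} \<and> F g \<noteq> 0"
        using nz F nth by metis
      fix g assume "g permutes {1..n}"
      then obtain i where i: "i < ?N" "g = gs ! i"
        using S by (metis in_set_conv_nth mem_Collect_eq)
      have "(\<Sum>j<?N. L $$ (i, j) * F (gs ! j)) = x * F (gs ! i)"
        using eig[OF i(1)] F i(1) by simp
      then show "(\<Sum>k=1..n. F (prefix_reversal k \<circ> g)) = (real n - x) * F g"
        using apply_L[OF i(1), of F] i(2) by (simp add: left_diff_distrib)
    qed (use assms(1) in simp)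
    then show "1 \<le> x" by simp
  next
    \<comment> \<open>This permutation sends 1 to 2, where the value is 1 because
      \<open>2 < n\<close>.\<close>
    have "Transposition.transpose 1 2 permutes {1..n}"
      using assms(1) by (intro permutes_swap_id) auto
    then obtain i where "i < ?N" "gs ! i = Transposition.transpose 1 2"
      using S by (metis in_set_conv_nth mem_Collect_eq)
    then show "\<exists>i<?N. gap_point_function n ((gs ! i) 1) \<noteq> 0"
      using assms(1) by (intro exI[of _ i]) (simp add: gap_point_function_def)
  next
    fix i assume i: "i < ?N"
    have "(gs ! i) 1 \<in> {1..n}"
      using permutes_in_image[OF nth[OF i], of 1] assms(1) by simp
    then show "(\<Sum>j<?N. L $$ (i, j) * gap_point_function n ((gs ! j) 1)) =
        1 * gap_point_function n ((gs ! i) 1)"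
      using apply_L[OF i, of "\<lambda>g. gap_point_function n (g 1)"]
        gap_point_function_eigen[OF assms(1), of "(gs ! i) 1"]
      by (simp add: left_diff_distrib)
  qed simp
  then show ?thesis by (simp add: spectral_gap_def L_def)
qed

end
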